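(* Let $f\in\mathcal F_{<\infty}(\mathbb R^n)$, $r>0$, $x_0\in\mathbb R^n$, and let $(x,z)$ be the $C^1(\mathbb R_{\ge0})$ solution of the NAG ODE $$\dot x(t)=\frac rt\,(z(t)-x(t)),\qquad \dot z(t)=-\frac tr\,\nabla f(x(t))\qquad(t>0),\qquad x(0)=z(0)=x_0.$$ Define $q(t):=-\frac{2(r+2)}{t^2}(x(t)-x(0))$ for $t>0$. Then: (a) For all $t>0$, $q(t)\in\operatorname{dom} f^*$. Suppose moreover that $\operatorname{dom} f^*$ has a minimum-norm point $p^\star$. Then: (b) For all $t>0$, $$\|q(t)-p^\star\|^2\le\frac{8(r+2)^2D_f(x_0,p^\star)}{t^2}.$$ (c) There is a constant $C$ independent of $t$ such that, for all sufficiently large $t$, $$\|q(t)\|^2-\|p^\star\|^2\le 4(r+2)^2D_f(x_0,p^\star)\,\frac{C+\log t}{t^2}.$$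
   Context: $\|\cdot\|$ and $\langle\cdot,\cdot\rangle$ are the Euclidean norm and inner product on $\mathbb R^n$. $\mathcal F_{<\infty}(\mathbb R^n):=\bigcup_{L>0}\mathcal F_L(\mathbb R^n)$, where $\mathcal F_L(\mathbb R^n)$ is the set of finite-valued differentiable convex functions $f:\mathbb R^n\to\mathbb R$ whose gradient is $L$-Lipschitz. The Legendre--Fenchel conjugate is $f^*(p):=\sup_{x\in\mathbb R^n}\{\langle p,x\rangle-f(x)\}\in\mathbb R\cup\{\infty\}$, and $\operatorname{dom} f^*:=\{p\in\mathbb R^n: f^*(p)<\infty\}$ (convex, nonempty, not necessarily closed). The dual divergence is $D_f(x,p):=f(x)+f^*(p)-\langle p,x\rangle$. The NAG ODE is known to have a unique solution in $C^1(\mathbb R_{\ge0})$, $\mathbb R_{\ge0}=[0,\infty)$. *)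

theory Defs
  imports "HOL-Analysis.Analysis"
begin

definition grad :: "('a::euclidean_space \<Rightarrow> real) \<Rightarrow> 'a \<Rightarrow> 'a" where
  "grad f x = (THE g. GDERIV f x :> g)"

lemma grad_eqI:
  fixes f :: "'a::euclidean_space \<Rightarrow> real"
  assumes "GDERIV f x :> g"
  shows "grad f x = g"
  unfolding grad_def
proof (rule the_equality)
  fix h assume "GDERIV f x :> h"
  then have "(\<lambda>v. v \<bullet> h) = (\<lambda>v. v \<bullet> g)"
    using assms unfolding gderiv_def by (intro has_derivative_unique[of f _ x])
  then show "h = g"
    by (simp add: fun_eq_iff vector_eq_ldot)
qed (fact assms)

lemma differentiable_imp_GDERIV_grad:
  fixes f :: "'a::euclidean_space \<Rightarrow> real"
  assumes "f differentiable (at x)"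
  shows "GDERIV f x :> grad f x"
proof -
  obtain f' where f': "(f has_derivative f') (at x)"
    using assms unfolding differentiable_def by blast
  then interpret bounded_linear f'
    by (rule has_derivative_bounded_linear)
  have "f' v = v \<bullet> (\<Sum>b\<in>Basis. f' b *\<^sub>R b)" for v
  proof -
    have "f' v = f' (\<Sum>b\<in>Basis. (v \<bullet> b) *\<^sub>R b)"
      by (simp only: euclidean_representation)
    also have "\<dots> = (\<Sum>b\<in>Basis. (v \<bullet> b) * f' b)"
      by (simp only: sum scaleR real_scaleR_def)
    also have "\<dots> = v \<bullet> (\<Sum>b\<in>Basis. f' b *\<^sub>R b)"
      by (simp only: inner_sum_right inner_scaleR_right mult.commute)
    finally show ?thesis .
  qed
  then have "f' = (\<lambda>v. v \<bullet> (\<Sum>b\<in>Basis. f' b *\<^sub>R b))"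
    by (rule ext)
  with f' have g: "GDERIV f x :> (\<Sum>b\<in>Basis. f' b *\<^sub>R b)"
    unfolding gderiv_def by (rule back_subst)
  show ?thesis
    using g unfolding grad_eqI[OF g] .
qed

definition smooth_convex :: "real \<Rightarrow> ('a::euclidean_space \<Rightarrow> real) set" where
  "smooth_convex L =
    {f. f differentiable_on UNIV \<and> convex_on UNIV f \<and> L-lipschitz_on UNIV (grad f)}"

definition smooth_convex_fin :: "('a::euclidean_space \<Rightarrow> real) set" where
  "smooth_convex_fin = (\<Union>L\<in>{0<..}. smooth_convex L)"

definition conjugate :: "('a::euclidean_space \<Rightarrow> real) \<Rightarrow> 'a \<Rightarrow> ereal" where
  "conjugate f p = (SUP x. ereal (p \<bullet> x - f x))"

definition conjugate_dom :: "('a::euclidean_space \<Rightarrow> real) \<Rightarrow> 'a set" where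
  "conjugate_dom f = {p. conjugate f p < \<infinity>}"

definition dual_div :: "('a::euclidean_space \<Rightarrow> real) \<Rightarrow> 'a \<Rightarrow> 'a \<Rightarrow> ereal" where
  "dual_div f x p = ereal (f x) + conjugate f p - ereal (p \<bullet> x)"

text \<open>
  \<open>C\<^sup>1\<close> on the closed half-line, with a one-sided derivative at 0. The library's
  \<open>C1_differentiable_on\<close> asks for a two-sided derivative at every point of the set, so it
  would constrain the values at negative times.
\<close>

definition C1_nonneg :: "(real \<Rightarrow> 'a::real_normed_vector) \<Rightarrow> bool" where
  "C1_nonneg x \<longleftrightarrow>
    (\<exists>x'. continuous_on {0..} x' \<and>
      (\<forall>t\<ge>0. (x has_vector_derivative x' t) (at t within {0..})))"

definition nag_solution ::
  "('a::euclidean_space \<Rightarrow> real) \<Rightarrow> real \<Rightarrow> 'a \<Rightarrow> (real \<Rightarrow> 'a) \<Rightarrow> (real \<Rightarrow> 'a) \<Rightarrow> bool" where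
  "nag_solution f r x0 x z \<longleftrightarrow>
    C1_nonneg x \<and> C1_nonneg z \<and> x 0 = x0 \<and> z 0 = x0 \<and>
    (\<forall>t>0. (x has_vector_derivative (r / t) *\<^sub>R (z t - x t)) (at t) \<and>
           (z has_vector_derivative - ((t / r) *\<^sub>R grad f (x t))) (at t))"

end

theory Submission imports Defs begin

text \<open>
  The ODE is \<open>x'' + ((r + 1) / t) x' + grad f (x) = 0\<close> with \<open>x' 0 = 0\<close>. For a source term \<open>h\<close>,
  the solution of \<open>u'' + ((r + 1) / t) u' = h\<close> with \<open>u 0 = u' 0 = 0\<close> is \<open>t\<^sup>2 / (2 (r + 2))\<close> times a
  weighted average of \<open>h\<close>. Hence \<open>q t\<close> is an average of gradients along the trajectory, and it
  inherits from them an upper bound on the conjugate; a maximum principle for the damped operator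
  replaces the integral.

  Let \<open>p\<close> be the minimum-norm point of the domain and \<open>y t = x t - x0 + (t\<^sup>2 / (2 (r + 2))) p\<close>, so that
  \<open>y'' + ((r + 1) / t) y' + (grad f (x) - p) = 0\<close> and \<open>q t - p = - (2 (r + 2) / t\<^sup>2) y t\<close>. Minimality
  of \<open>p\<close> gives \<open>k = (grad f (x) - p) \<bullet> p \<ge> 0\<close>, so the energy \<open>|y'|\<^sup>2 / 2 + D\<^sub>f(x, p)\<close> has derivative
  \<open>- ((r + 1) / t) |y'|\<^sup>2 - (t / (r + 2)) k \<le> 0\<close>. It starts at \<open>D = D\<^sub>f(x0, p)\<close>; thus \<open>|y'| \<le> sqrt (2 D)\<close>,
  which gives \<open>|y t| \<le> sqrt (2 D) t\<close> and the bound on \<open>|q t - p|\<close>. The integral of \<open>t k\<close> is at most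
  \<open>(r + 2) D\<close>, which bounds \<open>(q t - p) \<bullet> p\<close> by a multiple of \<open>D / t\<^sup>2\<close>. The norm estimate therefore holds
  even without the logarithm, with \<open>C = 2 + 1 / r\<close>.
\<close>

section \<open>Convexity, the conjugate domain and minimum-norm points\<close>

text \<open>On the line through \<open>a\<close> and \<open>b\<close> this is the one-variable
  tangent inequality at parameter 0, evaluated at 1.\<close>

lemma convex_on_gradient_inequality:
  fixes f :: "'a::euclidean_space \<Rightarrow> real"
  assumes "convex_on UNIV f" and "GDERIV f a :> g"
  shows "f a + g \<bullet> (b - a) \<le> f b"
proof -
  define \<phi> where "\<phi> \<tau> = f (a + \<tau> *\<^sub>R (b - a))" for \<tau> :: real
  have "convex_on UNIV \<phi>"
  proof (rule convex_onI)
    fix t u v :: real assume t: "0 < t" "t < 1"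
    have "a + ((1 - t) * u + t * v) *\<^sub>R (b - a)
        = (1 - t) *\<^sub>R (a + u *\<^sub>R (b - a)) + t *\<^sub>R (a + v *\<^sub>R (b - a))"
      by (simp add: algebra_simps)
    then show "\<phi> ((1 - t) *\<^sub>R u + t *\<^sub>R v) \<le> (1 - t) * \<phi> u + t * \<phi> v"
      using convex_onD[OF assms(1), of t "a + u *\<^sub>R (b - a)" "a + v *\<^sub>R (b - a)"] t
      by (simp add: \<phi>_def)
  qed simp
  moreover have "(\<phi> has_real_derivative g \<bullet> (b - a)) (at 0)"
  proof -
    have "((\<lambda>\<tau>. a + \<tau> *\<^sub>R (b - a)) has_derivative (\<lambda>h. h *\<^sub>R (b - a))) (at 0)"
      by (auto intro!: derivative_eq_intros)
    moreover have "(f has_derivative (\<lambda>h. h \<bullet> g)) (at (a + 0 *\<^sub>R (b - a)))"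
      using assms(2) by (simp add: gderiv_def)
    ultimately have "(\<phi> has_derivative (\<lambda>h. (h *\<^sub>R (b - a)) \<bullet> g)) (at 0)"
      unfolding \<phi>_def by (rule has_derivative_compose)
    then show ?thesis
      by (simp add: has_field_derivative_def inner_commute mult_commute_abs)
  qed
  ultimately have "(g \<bullet> (b - a)) * (1 - 0) \<le> \<phi> 1 - \<phi> 0"
    by (intro convex_on_imp_above_tangent[of UNIV]) auto
  then show ?thesis by (simp add: \<phi>_def)
qed

lemma conjugate_domI:
  assumes "\<And>y. p \<bullet> y - f y \<le> M"
  shows "p \<in> conjugate_dom f"
proof -
  have "conjugate f p \<le> ereal M"
    unfolding conjugate_def using assms by (auto intro: SUP_least)
  then show ?thesis
    by (auto simp: conjugate_dom_def)
qed

lemma conjugate_upper: "ereal (p \<bullet> y - f y) \<le> conjugate f p"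
  unfolding conjugate_def by (rule SUP_upper) simp

text \<open>The term at the origin excludes the value minus infinity, so membership in the domain
  yields a real value.\<close>

lemma conjugate_domE:
  assumes "p \<in> conjugate_dom f"
  obtains c where "conjugate f p = ereal c" and "\<And>y. p \<bullet> y - f y \<le> c"
proof -
  have "conjugate f p < \<infinity>"
    using assms by (simp add: conjugate_dom_def)
  moreover have "ereal (p \<bullet> 0 - f 0) \<le> conjugate f p"
    by (rule conjugate_upper)
  ultimately obtain c where c: "conjugate f p = ereal c"
    by (cases "conjugate f p") auto
  show thesis
    using that[OF c] conjugate_upper[of p _ f] by (simp add: c)
qed

lemma convex_conjugate_dom: "convex (conjugate_dom f)"
proof (rule convexI)
  fix p p' u v assume "p \<in> conjugate_dom f" "p' \<in> conjugate_dom f"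
    and uv: "0 \<le> u" "0 \<le> v" "u + v = (1::real)"
  then obtain c c' where c: "\<And>y. p \<bullet> y - f y \<le> c" and c': "\<And>y. p' \<bullet> y - f y \<le> c'"
    by (metis conjugate_domE)
  have "(u *\<^sub>R p + v *\<^sub>R p') \<bullet> y - f y \<le> u * c + v * c'" for y
  proof -
    have "u * f y + v * f y = f y"
      using uv(3) by (metis distrib_right mult_1)
    then have "(u *\<^sub>R p + v *\<^sub>R p') \<bullet> y - f y = u * (p \<bullet> y - f y) + v * (p' \<bullet> y - f y)"
      by (simp add: inner_add_left right_diff_distrib)
    also have "\<dots> \<le> u * c + v * c'"
      using uv c c' by (intro add_mono mult_left_mono)
    finally show ?thesis .
  qed
  then show "u *\<^sub>R p + v *\<^sub>R p' \<in> conjugate_dom f"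
    by (rule conjugate_domI)
qed

text \<open>Variational inequality for the projection of the origin: if it failed, a short step from
  \<open>p\<close> towards \<open>s\<close> would stay in \<open>S\<close> and reduce the
  norm.\<close>

lemma min_norm_inner_nonneg:
  fixes p :: "'a::euclidean_space"
  assumes "convex S" and "is_arg_min norm (\<lambda>p. p \<in> S) p" and "s \<in> S"
  shows "0 \<le> (s - p) \<bullet> p"
proof (rule ccontr)
  assume "\<not> 0 \<le> (s - p) \<bullet> p"
  then have "(0 - p) \<bullet> (s - p) > 0"
    by (simp add: inner_commute)
  then obtain u where u: "u > 0" "u \<le> 1" "dist (p + u *\<^sub>R (s - p)) 0 < dist p 0"
    using closer_point_lemma[of 0 p s] by auto
  have "p \<in> S" and min: "\<And>w. w \<in> S \<Longrightarrow> norm p \<le> norm w"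
    using assms(2) by (auto simp: is_arg_min_def not_less)
  then have "(1 - u) *\<^sub>R p + u *\<^sub>R s \<in> S"
    using assms(1,3) u by (intro convexD) auto
  then show False
    using min u(3) by (fastforce simp: algebra_simps)
qed

section \<open>A maximum principle for damped inequalities\<close>

text \<open>
  Up to a positive factor, the last hypothesis bounds the derivative of \<open>t powr a * w t\<close>.
\<close>

lemma damped_nonpos:
  fixes w w' :: "real \<Rightarrow> real"
  assumes "a > 0" and "T \<ge> 0" and "w 0 = 0" and cont: "continuous_on {0..T} w"
    and deriv: "\<And>t. \<lbrakk>0 < t; t < T\<rbrakk> \<Longrightarrow> (w has_real_derivative w' t) (at t)"
    and le: "\<And>t. \<lbrakk>0 < t; t < T\<rbrakk> \<Longrightarrow> w' t + a / t * w t \<le> 0"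
  shows "w T \<le> 0"
proof (cases "T = 0")
  case False
  then have T: "T > 0" using assms by simp
  define \<phi> where "\<phi> t = t powr a * w t" for t
  have "\<phi> T \<le> \<phi> 0"
  proof (rule DERIV_nonpos_imp_decreasing_open[of 0 T \<phi>])
    fix t assume t: "0 < t" "t < T"
    have "(\<phi> has_real_derivative a * t powr (a - 1) * w t + t powr a * w' t) (at t)"
      unfolding \<phi>_def using t deriv[OF t]
      by (auto intro!: derivative_eq_intros has_real_derivative_powr)
    moreover have "a * t powr (a - 1) * w t + t powr a * w' t = t powr a * (w' t + a / t * w t)"
      using t by (simp add: powr_diff field_simps)
    moreover have "\<dots> \<le> 0"
      using le[OF t] by (simp add: mult_nonneg_nonpos)
    ultimately show "\<exists>y. DERIV \<phi> t :> y \<and> y \<le> 0" by auto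
  next
    \<comment> \<open>At the endpoint 0 it is \<open>a > 0\<close> that keeps
      \<open>t powr a\<close> continuous.\<close>
    show "continuous_on {0..T} \<phi>"
      unfolding \<phi>_def using \<open>a > 0\<close> by (intro continuous_intros continuous_on_powr' cont) auto
  qed (use T in simp)
  then show ?thesis
    using T by (simp add: \<phi>_def mult_le_0_iff)
qed (use assms in simp)

section \<open>Regularity along the trajectory and the initial velocity\<close>

locale nag_flow =
  fixes f :: "'a::euclidean_space \<Rightarrow> real" and r :: real and x0 :: 'a and x z :: "real \<Rightarrow> 'a"
  assumes f: "f \<in> smooth_convex_fin" and r: "r > 0" and sol: "nag_solution f r x0 x z"
begin

lemma GDERIV_grad: "GDERIV f y :> grad f y"
proof -
  have "f differentiable_on UNIV"
    using f by (auto simp: smooth_convex_fin_def smooth_convex_def)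
  then show ?thesis
    by (auto intro: differentiable_imp_GDERIV_grad simp: differentiable_on_def)
qed

lemma gradient_inequality: "f y + grad f y \<bullet> (v - y) \<le> f v"
  using f GDERIV_grad
  by (intro convex_on_gradient_inequality) (auto simp: smooth_convex_fin_def smooth_convex_def)

lemma continuous_on_f: "continuous_on S f"
  by (meson GDERIV_grad continuous_at_imp_continuous_on gderiv_def has_derivative_continuous)

lemma continuous_on_grad: "continuous_on S (grad f)"
  using f by (auto simp: smooth_convex_fin_def smooth_convex_def
      intro: lipschitz_on_continuous_on continuous_on_subset)

text \<open>The gradient inequality makes \<open>y\<close> a maximizer in the supremum that defines
  the conjugate at \<open>grad f y\<close>.\<close>

lemma grad_in_conjugate_dom: "grad f y \<in> conjugate_dom f"
  using gradient_inequality[of y] by (intro conjugate_domI[of _ _ "grad f y \<bullet> y - f y"])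
    (simp add: inner_diff_right algebra_simps)

lemma x_0: "x 0 = x0" and z_0: "z 0 = x0"
  using sol by (auto simp: nag_solution_def)

lemma C1_x: "C1_nonneg x" and C1_z: "C1_nonneg z"
  using sol by (auto simp: nag_solution_def)

lemma C1_nonneg_continuous_on: "C1_nonneg u \<Longrightarrow> continuous_on {0..} u"
  unfolding C1_nonneg_def continuous_on_eq_continuous_within
  by (auto intro: has_vector_derivative_continuous)

lemma continuous_on_x: "continuous_on {0..} x" and continuous_on_z: "continuous_on {0..} z"
  using C1_x C1_z by (auto intro: C1_nonneg_continuous_on)

text \<open>Since \<open>r / 0 = 0\<close>, the formula gives \<open>vel 0 = 0\<close>, which is the correct initial velocity.\<close>

definition vel :: "real \<Rightarrow> 'a" where
  "vel t = (r / t) *\<^sub>R (z t - x t)"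

lemma vel_0 [simp]: "vel 0 = 0"
  by (simp add: vel_def)

lemma x_deriv: "t > 0 \<Longrightarrow> (x has_vector_derivative vel t) (at t)"
  and z_deriv: "t > 0 \<Longrightarrow> (z has_vector_derivative - ((t / r) *\<^sub>R grad f (x t))) (at t)"
  using sol by (auto simp: nag_solution_def vel_def)

text \<open>Differentiating the definition of \<open>vel\<close> eliminates \<open>z\<close> and
  gives the second-order form of the ODE.\<close>

lemma vel_deriv:
  assumes "t > 0"
  shows "(vel has_vector_derivative - (((r + 1) / t) *\<^sub>R vel t) - grad f (x t)) (at t)"
proof -
  have "(vel has_vector_derivative (r / t) *\<^sub>R (- ((t / r) *\<^sub>R grad f (x t)) - vel t)
      + (- r / t\<^sup>2) *\<^sub>R (z t - x t)) (at t)"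
    unfolding vel_def[abs_def] using assms x_deriv[OF assms] z_deriv[OF assms]
    by (auto intro!: derivative_eq_intros simp: vel_def power2_eq_square)
  moreover have "(r / t) *\<^sub>R (- ((t / r) *\<^sub>R grad f (x t)) - vel t)
      + (- r / t\<^sup>2) *\<^sub>R (z t - x t) = - (((r + 1) / t) *\<^sub>R vel t) - grad f (x t)"
    using assms r by (simp add: vel_def algebra_simps power2_eq_square add_divide_distrib)
  ultimately show ?thesis by simp
qed

text \<open>The common limit \<open>d\<close> is the one-sided derivative at 0: \<open>u'\<close>
  tends to it by continuity of the derivative, the difference quotient by definition. Comparing both
  limits determines the initial velocity.\<close>

lemma C1_derivative_limit:
  assumes "C1_nonneg u" and deriv: "\<And>t. t > 0 \<Longrightarrow> (u has_vector_derivative u' t) (at t)"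
  obtains d where "(u' \<longlongrightarrow> d) (at_right 0)"
    and "((\<lambda>t. (u t - u 0) /\<^sub>R t) \<longlongrightarrow> d) (at_right 0)"
proof -
  obtain v where v: "continuous_on {0..} v"
    and uv: "\<And>t. t \<ge> 0 \<Longrightarrow> (u has_vector_derivative v t) (at t within {0..})"
    using assms(1) unfolding C1_nonneg_def by auto
  have eq: "v t = u' t" if "t > 0" for t
  proof -
    have "(u has_vector_derivative v t) (at t)"
      using uv[of t] that at_within_interior[of t "{0..}"] by (simp add: interior_Ici[of "-1"])
    then show ?thesis
      using deriv[OF that] vector_derivative_unique_at by blast
  qed
  have "(v \<longlongrightarrow> v 0) (at_right 0)"
    using v unfolding continuous_on_def
    by (auto intro: tendsto_within_subset[of _ _ _ "{0..}"])
  then have "(u' \<longlongrightarrow> v 0) (at_right 0)"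
    by (rule Lim_transform_eventually) (auto simp: eventually_at_filter eq)
  moreover have "((\<lambda>t. (u t - u 0) /\<^sub>R t) \<longlongrightarrow> v 0) (at_right 0)"
  proof -
    \<comment> \<open>The normalized remainder in the definition of the derivative; for
      \<open>t > 0\<close>, adding \<open>v 0\<close> turns it into the difference quotient.\<close>
    have "((\<lambda>t. (1 / norm t) *\<^sub>R (u t - (u 0 + t *\<^sub>R v 0)) + v 0) \<longlongrightarrow> 0 + v 0) (at_right 0)"
      using uv[of 0]
      by (intro tendsto_add tendsto_const)
        (simp add: has_vector_derivative_def has_derivative_within at_within_Ici_at_right)
    then have "((\<lambda>t. (1 / norm t) *\<^sub>R (u t - (u 0 + t *\<^sub>R v 0)) + v 0) \<longlongrightarrow> v 0) (at_right 0)"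
      by simp
    then show ?thesis
      by (rule Lim_transform_eventually)
        (auto simp: eventually_at_filter algebra_simps inverse_eq_divide)
  qed
  ultimately show thesis by (rule that)
qed

text \<open>With \<open>d\<close> and \<open>e\<close> the initial derivatives of \<open>x\<close>
  and \<open>z\<close>, the ODE forces \<open>e = 0\<close> and, through difference quotients,
  \<open>d = r *\<^sub>R (e - d)\<close>. Hence \<open>(1 + r) *\<^sub>R d = 0\<close>.\<close>

lemma vel_tendsto_0: "(vel \<longlongrightarrow> 0) (at_right 0)"
proof -
  obtain d where d: "(vel \<longlongrightarrow> d) (at_right 0)" "((\<lambda>t. (x t - x0) /\<^sub>R t) \<longlongrightarrow> d) (at_right 0)"
    using C1_derivative_limit[OF C1_x x_deriv] x_0 by auto
  obtain e where e: "((\<lambda>t. - ((t / r) *\<^sub>R grad f (x t))) \<longlongrightarrow> e) (at_right 0)"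
      "((\<lambda>t. (z t - x0) /\<^sub>R t) \<longlongrightarrow> e) (at_right 0)"
    using C1_derivative_limit[OF C1_z z_deriv] z_0 by auto
  have "continuous_on {0..} (\<lambda>t. - ((t / r) *\<^sub>R grad f (x t)))"
    using r by (intro continuous_intros continuous_on_compose2[OF continuous_on_grad continuous_on_x])
      auto
  then have "((\<lambda>t. - ((t / r) *\<^sub>R grad f (x t))) \<longlongrightarrow> 0) (at 0 within {0..})"
    unfolding continuous_on_def by force
  then have "((\<lambda>t. - ((t / r) *\<^sub>R grad f (x t))) \<longlongrightarrow> 0) (at_right 0)"
    by (rule tendsto_within_subset) auto
  then have "e = 0"
    using e(1) tendsto_unique trivial_limit_at_right_real by blast
  have "((\<lambda>t. r *\<^sub>R ((z t - x0) /\<^sub>R t - (x t - x0) /\<^sub>R t)) \<longlongrightarrow> r *\<^sub>R (e - d)) (at_right 0)"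
    by (intro tendsto_intros d e)
  moreover have "(\<lambda>t. r *\<^sub>R ((z t - x0) /\<^sub>R t - (x t - x0) /\<^sub>R t)) = vel"
    by (simp add: fun_eq_iff vel_def divide_inverse flip: scaleR_diff_right)
  ultimately have "d = r *\<^sub>R (e - d)"
    using d(1) tendsto_unique trivial_limit_at_right_real by metis
  then have "d + r *\<^sub>R d = 0"
    by (metis \<open>e = 0\<close> add.right_inverse diff_0 scaleR_minus_right add.commute)
  then have "(1 + r) *\<^sub>R d = 0"
    by (simp add: scaleR_add_left)
  with r d(1) show ?thesis by simp
qed

lemma continuous_on_vel: "continuous_on {0..} vel"
  unfolding continuous_on_def
proof
  fix t :: real assume "t \<in> {0..}"
  then consider "t = 0" | "t > 0" by fastforce
  then show "(vel \<longlongrightarrow> vel t) (at t within {0..})"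
  proof cases
    case 1
    then show ?thesis
      using vel_tendsto_0 by (simp add: at_within_Ici_at_right)
  next
    case 2
    then show ?thesis
      using has_vector_derivative_continuous[OF has_vector_derivative_at_within[OF vel_deriv]]
      by (simp add: continuous_within)
  qed
qed

lemma inner_x_deriv: "t > 0 \<Longrightarrow> ((\<lambda>t. x t \<bullet> v) has_real_derivative vel t \<bullet> v) (at t)"
  and inner_z_deriv: "t > 0 \<Longrightarrow>
    ((\<lambda>t. z t \<bullet> v) has_real_derivative - (t / r * (grad f (x t) \<bullet> v))) (at t)"
  and inner_vel_deriv: "t > 0 \<Longrightarrow>
    ((\<lambda>t. vel t \<bullet> v) has_real_derivative - ((r + 1) / t * (vel t \<bullet> v)) - grad f (x t) \<bullet> v) (at t)"
  using bounded_linear.has_vector_derivative[OF bounded_linear_inner_left[of v] x_deriv[of t]]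
    bounded_linear.has_vector_derivative[OF bounded_linear_inner_left[of v] z_deriv[of t]]
    bounded_linear.has_vector_derivative[OF bounded_linear_inner_left[of v] vel_deriv[of t]]
  by (simp_all add: has_real_derivative_iff_has_vector_derivative inner_diff_left)

lemma f_x_deriv:
  assumes "t > 0"
  shows "((\<lambda>t. f (x t)) has_real_derivative grad f (x t) \<bullet> vel t) (at t)"
proof -
  have "((\<lambda>t. f (x t)) has_derivative (\<lambda>h. (h *\<^sub>R vel t) \<bullet> grad f (x t))) (at t)"
    using x_deriv[OF assms] GDERIV_grad[of "x t"]
    unfolding has_vector_derivative_def gderiv_def by (rule has_derivative_compose)
  then show ?thesis
    by (simp add: has_field_derivative_def inner_commute mult_commute_abs)
qed

section \<open>Membership of the rescaled displacement in the conjugate domain\<close>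

lemma rescaled_displacement_in_conjugate_dom:
  assumes "t > 0"
  shows "- ((2 * (r + 2) / t\<^sup>2) *\<^sub>R (x t - x0)) \<in> conjugate_dom f"
proof -
  \<comment> \<open>This function is the value of the conjugate at \<open>grad f (x s)\<close>;
    compactness of \<open>{0..t}\<close> bounds it by one \<open>M\<close>, independent of the test
    point \<open>v\<close> below.\<close>
  have "continuous_on {0..t} (\<lambda>s. grad f (x s) \<bullet> x s - f (x s))"
    by (intro continuous_intros continuous_on_compose2[OF continuous_on_grad]
        continuous_on_compose2[OF continuous_on_f] continuous_on_subset[OF continuous_on_x]) auto
  from continuous_attains_sup[OF compact_Icc _ this] assms
  obtain M where M: "\<And>s. \<lbrakk>0 \<le> s; s \<le> t\<rbrakk> \<Longrightarrow> grad f (x s) \<bullet> x s - f (x s) \<le> M"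
    by fastforce
  show ?thesis
  proof (rule conjugate_domI)
    fix v
    \<comment> \<open>\<open>w\<close> is the derivative of \<open>u\<close>. The slope
      \<open>s / (r + 2)\<close> solves the damped equation with unit source, so the source for
      \<open>w\<close> is \<open>grad f (x s) \<bullet> v - (f v + M)\<close>, nonpositive by
      convexity and the choice of \<open>M\<close>.\<close>
    define w where "w s = - (vel s \<bullet> v) - s / (r + 2) * (f v + M)" for s
    define u where "u s = - ((x s - x0) \<bullet> v) - s\<^sup>2 / (2 * (r + 2)) * (f v + M)" for s
    have w_nonpos: "w T \<le> 0" if T: "0 \<le> T" "T \<le> t" for T
    proof (rule damped_nonpos[where w = w and T = T and a = "r + 1"
          and w' = "\<lambda>s. (r + 1) / s * (vel s \<bullet> v) + grad f (x s) \<bullet> v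
          - 1 / (r + 2) * (f v + M)"])
      show "r + 1 > 0" using r by simp
      show "0 \<le> T" by fact
      show "w 0 = 0" by (simp add: w_def)
      show "continuous_on {0..T} w"
        unfolding w_def using r
        by (intro continuous_intros continuous_on_subset[OF continuous_on_vel]) auto
    next
      fix s assume s: "0 < s" "s < T"
      let ?w' = "(r + 1) / s * (vel s \<bullet> v) + grad f (x s) \<bullet> v - 1 / (r + 2) * (f v + M)"
      show "(w has_real_derivative ?w') (at s)"
        unfolding w_def using r s(1) by (auto intro!: derivative_eq_intros inner_vel_deriv)
      have "?w' + (r + 1) / s * w s = grad f (x s) \<bullet> v - (f v + M)"
      proof -
        have "(r + 1) / s * (s / (r + 2)) + 1 / (r + 2) = 1"
          using r s by (simp add: add_divide_distrib[symmetric])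
        then have "(r + 1) / s * (s / (r + 2) * (f v + M)) + 1 / (r + 2) * (f v + M) = f v + M"
          by (metis distrib_right mult.assoc mult_1)
        then show ?thesis
          unfolding w_def right_diff_distrib by simp
      qed
      also have "\<dots> \<le> 0"
        using gradient_inequality[of "x s" v] M[of s] s T by (simp add: inner_diff_right)
      finally show "?w' + (r + 1) / s * w s \<le> 0" .
    qed
    have "u t \<le> u 0"
    proof (rule DERIV_nonpos_imp_decreasing_open[of 0 t u])
      fix s assume s: "0 < s" "s < t"
      have "(u has_real_derivative - (vel s \<bullet> v - 0) - (2 * s / (2 * (r + 2))) * (f v + M)) (at s)"
        unfolding u_def inner_diff_left using r s(1)
        by (intro derivative_intros inner_x_deriv) (auto intro!: derivative_eq_intros)
      moreover have "2 * s / (2 * (r + 2)) = s / (r + 2)"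
        by (rule mult_divide_mult_cancel_left) simp
      ultimately have "(u has_real_derivative w s) (at s)"
        by (simp only: w_def diff_0_right)
      then show "\<exists>y. (u has_real_derivative y) (at s) \<and> y \<le> 0"
        using w_nonpos[of s] s by auto
    next
      show "continuous_on {0..t} u"
        unfolding u_def using r
        by (intro continuous_intros continuous_on_subset[OF continuous_on_x]) auto
    qed (use assms in simp)
    then have "u t \<le> 0" by (simp add: u_def x_0)
    then have "2 * (r + 2) / t\<^sup>2 * u t \<le> 0"
      using r by (intro mult_nonneg_nonpos) auto
    moreover have "2 * (r + 2) / t\<^sup>2 * u t
        = - ((2 * (r + 2) / t\<^sup>2) *\<^sub>R (x t - x0)) \<bullet> v - (f v + M)"
    proof -
      have "2 * (r + 2) / t\<^sup>2 * (t\<^sup>2 / (2 * (r + 2))) = 1"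
        using r assms by simp
      then show ?thesis
        unfolding u_def right_diff_distrib mult.assoc[symmetric] by simp
    qed
    ultimately show "- ((2 * (r + 2) / t\<^sup>2) *\<^sub>R (x t - x0)) \<bullet> v - f v \<le> M"
      by simp
  qed
qed

end

section \<open>The trajectory relative to the minimum-norm point\<close>

text \<open>Naming the finite conjugate value \<open>c\<close> lets the divergence be treated in
  real arithmetic.\<close>

locale nag_flow_min_norm = nag_flow +
  fixes p :: 'a and c :: real
  assumes min_p: "is_arg_min norm (\<lambda>p. p \<in> conjugate_dom f) p"
    and c: "conjugate f p = ereal c"
begin

definition gap :: "'a \<Rightarrow> real" where
  "gap y = f y + c - p \<bullet> y"

lemma gap_nonneg: "gap y \<ge> 0"
  using conjugate_upper[of p y f] by (simp add: gap_def c)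

lemma dual_div_eq_gap: "dual_div f y p = ereal (gap y)"
  by (simp add: dual_div_def c gap_def)

text \<open>This is where minimality of \<open>p\<close> enters: it fixes the sign of the source
  along \<open>p\<close> and of one dissipation term of the energy.\<close>

lemma grad_minus_p_inner_nonneg: "0 \<le> (grad f y - p) \<bullet> p"
  by (rule min_norm_inner_nonneg[OF convex_conjugate_dom min_p grad_in_conjugate_dom])

text \<open>
  The parabola is chosen such that \<open>shifted\<close> solves the second-order form of the ODE with
  \<open>grad f (x t) - p\<close> in place of \<open>grad f (x t)\<close>, and \<open>shifted t = (t\<^sup>2 / (2 (r + 2))) (p - q t)\<close>
  in the notation of the theorem.
\<close>

definition shifted :: "real \<Rightarrow> 'a" where
  "shifted t = x t - x0 + (t\<^sup>2 / (2 * (r + 2))) *\<^sub>R p"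

definition shifted_vel :: "real \<Rightarrow> 'a" where
  "shifted_vel t = vel t + (t / (r + 2)) *\<^sub>R p"

lemma shifted_0: "shifted 0 = 0"
  by (simp add: shifted_def x_0)

lemma continuous_on_shifted: "continuous_on {0..} shifted"
  unfolding shifted_def[abs_def] using r by (intro continuous_intros continuous_on_x) auto

lemma continuous_on_shifted_vel: "continuous_on {0..} shifted_vel"
  unfolding shifted_vel_def[abs_def] using r by (intro continuous_intros continuous_on_vel) auto

lemma shifted_deriv:
  assumes "t > 0"
  shows "(shifted has_vector_derivative shifted_vel t) (at t)"
proof -
  have "(shifted has_vector_derivative vel t - 0 + (2 * t / (2 * (r + 2))) *\<^sub>R p) (at t)"
    unfolding shifted_def[abs_def] using r x_deriv[OF assms]
    by (intro derivative_intros) (auto intro!: derivative_eq_intros)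
  moreover have "2 * t / (2 * (r + 2)) = t / (r + 2)"
    by (rule mult_divide_mult_cancel_left) simp
  ultimately show ?thesis by (simp add: shifted_vel_def)
qed

lemma shifted_vel_deriv:
  assumes "t > 0"
  shows "(shifted_vel has_vector_derivative
    - (((r + 1) / t) *\<^sub>R shifted_vel t) - (grad f (x t) - p)) (at t)"
proof -
  have "(shifted_vel has_vector_derivative
      - (((r + 1) / t) *\<^sub>R vel t) - grad f (x t) + (1 / (r + 2)) *\<^sub>R p) (at t)"
    unfolding shifted_vel_def[abs_def] using r vel_deriv[OF assms]
    by (auto intro!: derivative_eq_intros)
  moreover have "((r + 1) / t) *\<^sub>R shifted_vel t + (1 / (r + 2)) *\<^sub>R p
      = ((r + 1) / t) *\<^sub>R vel t + p"
  proof -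
    have "((r + 1) / t) *\<^sub>R shifted_vel t + (1 / (r + 2)) *\<^sub>R p
        = ((r + 1) / t) *\<^sub>R vel t + ((r + 1) / t * (t / (r + 2)) + 1 / (r + 2)) *\<^sub>R p"
      by (simp only: shifted_vel_def scaleR_add_right scaleR_add_left scaleR_scaleR add.assoc)
    also have "(r + 1) / t * (t / (r + 2)) + 1 / (r + 2) = 1"
      using assms r by (simp add: add_divide_distrib[symmetric])
    finally show ?thesis by simp
  qed
  then have "- (((r + 1) / t) *\<^sub>R vel t) - grad f (x t) + (1 / (r + 2)) *\<^sub>R p
      = - (((r + 1) / t) *\<^sub>R shifted_vel t) - (grad f (x t) - p)"
    by (simp add: algebra_simps)
  ultimately show ?thesis by simp
qed

text \<open>The component along \<open>p\<close> starts at 0 and obeys a damped equation with source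
  \<open>- ((grad f (x s) - p) \<bullet> p)\<close>.\<close>

lemma inner_shifted_vel_nonpos:
  assumes "t \<ge> 0"
  shows "shifted_vel t \<bullet> p \<le> 0"
proof (rule damped_nonpos[where w = "\<lambda>t. shifted_vel t \<bullet> p" and a = "r + 1" and T = t
      and w' = "\<lambda>s. - ((r + 1) / s * (shifted_vel s \<bullet> p)) - (grad f (x s) - p) \<bullet> p"])
  show "continuous_on {0..t} (\<lambda>t. shifted_vel t \<bullet> p)"
    by (intro continuous_intros continuous_on_subset[OF continuous_on_shifted_vel]) auto
next
  fix s :: real assume s: "0 < s"
  show "((\<lambda>t. shifted_vel t \<bullet> p) has_real_derivative
      - ((r + 1) / s * (shifted_vel s \<bullet> p)) - (grad f (x s) - p) \<bullet> p) (at s)"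
    using bounded_linear.has_vector_derivative[OF bounded_linear_inner_left[of p] shifted_vel_deriv[OF s]]
    by (simp add: has_real_derivative_iff_has_vector_derivative inner_diff_left)
  show "- ((r + 1) / s * (shifted_vel s \<bullet> p)) - (grad f (x s) - p) \<bullet> p
      + (r + 1) / s * (shifted_vel s \<bullet> p) \<le> 0"
    using grad_minus_p_inner_nonneg by simp
qed (use r assms in \<open>auto simp: shifted_vel_def\<close>)

section \<open>Energy dissipation and its consequences\<close>

definition energy :: "real \<Rightarrow> real" where
  "energy t = (shifted_vel t \<bullet> shifted_vel t) / 2 + gap (x t)"

lemma energy_0: "energy 0 = gap x0"
  by (simp add: energy_def shifted_vel_def x_0)

lemma continuous_on_energy: "continuous_on {0..} energy"
  unfolding energy_def[abs_def] gap_def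
  by (intro continuous_intros continuous_on_shifted_vel continuous_on_x
      continuous_on_compose2[OF continuous_on_f continuous_on_x]) auto

text \<open>The kinetic part pairs \<open>grad f (x t) - p\<close> with
  \<open>shifted_vel t\<close>, the potential part with \<open>vel t\<close>. Their mismatch
  \<open>(t / (r + 2)) *\<^sub>R p\<close> produces the second dissipation term.\<close>

lemma energy_deriv:
  assumes "t > 0"
  shows "(energy has_real_derivative - ((r + 1) / t * (shifted_vel t \<bullet> shifted_vel t))
    - t / (r + 2) * ((grad f (x t) - p) \<bullet> p)) (at t)"
proof -
  let ?a = "- (((r + 1) / t) *\<^sub>R shifted_vel t) - (grad f (x t) - p)"
  have "((\<lambda>t. shifted_vel t \<bullet> shifted_vel t) has_real_derivative 2 * (shifted_vel t \<bullet> ?a)) (at t)"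
    using bounded_bilinear.has_vector_derivative[OF bounded_bilinear_inner
        shifted_vel_deriv[OF assms] shifted_vel_deriv[OF assms]]
    by (simp add: has_real_derivative_iff_has_vector_derivative inner_commute)
  moreover have "((\<lambda>t. gap (x t)) has_real_derivative (grad f (x t) - p) \<bullet> vel t) (at t)"
    unfolding gap_def using f_x_deriv[OF assms] inner_x_deriv[OF assms, of p]
    by (auto intro!: derivative_eq_intros simp: inner_diff_left inner_commute[of p])
  ultimately have "(energy has_real_derivative
      2 * (shifted_vel t \<bullet> ?a) / 2 + (grad f (x t) - p) \<bullet> vel t) (at t)"
    unfolding energy_def[abs_def] by (intro DERIV_add DERIV_cdivide)
  moreover have "2 * (shifted_vel t \<bullet> ?a) / 2 + (grad f (x t) - p) \<bullet> vel t
      = - ((r + 1) / t * (shifted_vel t \<bullet> shifted_vel t)) - (grad f (x t) - p) \<bullet> (shifted_vel t - vel t)"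
    using inner_commute[of "shifted_vel t" "grad f (x t) - p"] by (simp add: inner_diff_right)
  moreover have "shifted_vel t - vel t = (t / (r + 2)) *\<^sub>R p"
    by (simp add: shifted_vel_def)
  ultimately show ?thesis by simp
qed

lemma energy_le:
  assumes "t \<ge> 0"
  shows "energy t \<le> gap x0"
proof -
  have "energy t \<le> energy 0"
  proof (rule DERIV_nonpos_imp_decreasing_open[of 0 t energy])
    fix s :: real assume s: "0 < s"
    have "0 \<le> (r + 1) / s * (shifted_vel s \<bullet> shifted_vel s)"
      and "0 \<le> s / (r + 2) * ((grad f (x s) - p) \<bullet> p)"
      using r s grad_minus_p_inner_nonneg[of "x s"] by (simp_all add: mult_nonneg_nonneg)
    then have "- ((r + 1) / s * (shifted_vel s \<bullet> shifted_vel s))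
        - s / (r + 2) * ((grad f (x s) - p) \<bullet> p) \<le> 0"
      by linarith
    then show "\<exists>y. (energy has_real_derivative y) (at s) \<and> y \<le> 0"
      using energy_deriv[OF s] by blast
  qed (use assms in \<open>auto intro: continuous_on_subset[OF continuous_on_energy]\<close>)
  then show ?thesis by (simp add: energy_0)
qed

lemma norm_shifted_vel_le:
  assumes "t \<ge> 0"
  shows "norm (shifted_vel t) \<le> sqrt (2 * gap x0)"
  using energy_le[OF assms] gap_nonneg[of "x t"]
  by (simp add: energy_def norm_eq_sqrt_inner)

lemma norm_shifted_le:
  assumes "t > 0"
  shows "norm (shifted t) \<le> sqrt (2 * gap x0) * t"
proof -
  have "\<exists>s\<in>{0<..<t}. norm (shifted t - shifted 0) \<le> norm ((t - 0) *\<^sub>R shifted_vel s)"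
    using assms shifted_deriv
    by (intro mvt_general continuous_on_subset[OF continuous_on_shifted])
      (auto simp: has_vector_derivative_def)
  then obtain s where s: "s > 0" "norm (shifted t) \<le> t * norm (shifted_vel s)"
    using assms by (auto simp: shifted_0)
  have "t * norm (shifted_vel s) \<le> t * sqrt (2 * gap x0)"
    using assms s norm_shifted_vel_le[of s] by (intro mult_left_mono) auto
  with s show ?thesis by (simp add: mult.commute)
qed

text \<open>
  The combination \<open>r * shifted + t * shifted_vel\<close> has derivative \<open>t *\<^sub>R (p - grad f (x t))\<close>, whose
  component along \<open>p\<close> is controlled by the dissipation of the energy.
\<close>

lemma inner_shifted_ge:
  assumes "t \<ge> 0"
  shows "- (shifted t \<bullet> p) \<le> (r + 2) / r * gap x0"
proof -
  \<comment> \<open>\<open>m\<close> is minus the component along \<open>p\<close> of the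
    combination above, rewritten using
    \<open>r *\<^sub>R x t + t *\<^sub>R vel t = r *\<^sub>R z t\<close>, so that its derivative
    comes from the equation for \<open>z\<close>.\<close>
  define m where "m t = - (r * ((z t - x0) \<bullet> p)) - t\<^sup>2 / 2 * (p \<bullet> p)" for t
  \<comment> \<open>The factor \<open>r + 2\<close> makes the growth \<open>s * ?k\<close> of
    \<open>m\<close> cancel against the energy dissipation, leaving only a nonpositive multiple of
    \<open>?v\<close>.\<close>
  have "m t + (r + 2) * energy t \<le> m 0 + (r + 2) * energy 0"
  proof (rule DERIV_nonpos_imp_decreasing_open[of 0 t "\<lambda>t. m t + (r + 2) * energy t"])
    fix s :: real assume s: "0 < s"
    let ?k = "(grad f (x s) - p) \<bullet> p" and ?v = "shifted_vel s \<bullet> shifted_vel s"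
    have m': "(m has_real_derivative s * ?k) (at s)"
      unfolding m_def inner_diff_left using r
      by (auto intro!: derivative_eq_intros inner_z_deriv[OF s] simp: algebra_simps)
    have "((\<lambda>t. m t + (r + 2) * energy t) has_real_derivative
        s * ?k + (r + 2) * (- ((r + 1) / s * ?v) - s / (r + 2) * ?k)) (at s)"
      by (intro DERIV_add m' DERIV_cmult energy_deriv[OF s])
    moreover have "s * ?k + (r + 2) * (- ((r + 1) / s * ?v) - s / (r + 2) * ?k)
        = - ((r + 2) * ((r + 1) / s * ?v))"
      using r by (simp add: right_diff_distrib)
    moreover have "\<dots> \<le> 0"
      using r s by simp
    ultimately show "\<exists>y. ((\<lambda>t. m t + (r + 2) * energy t) has_real_derivative y) (at s) \<and> y \<le> 0"
      by auto
  next
    show "continuous_on {0..t} (\<lambda>t. m t + (r + 2) * energy t)"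
      unfolding m_def
      by (intro continuous_intros continuous_on_subset[OF continuous_on_energy]
          continuous_on_subset[OF continuous_on_z]) auto
  qed (use assms in simp)
  moreover have "energy t \<ge> 0"
    using gap_nonneg by (simp add: energy_def)
  moreover have "m 0 = 0"
    by (simp add: m_def z_0)
  ultimately have "m t \<le> (r + 2) * gap x0"
    using r by (simp add: energy_0) (smt (verit) mult_nonneg_nonneg)
  moreover have "m t = - (r * (shifted t \<bullet> p)) - t * (shifted_vel t \<bullet> p)"
  proof -
    \<comment> \<open>At \<open>t = 0\<close> both sides vanish because \<open>x\<close> and
      \<open>z\<close> start at the same point.\<close>
    have "t *\<^sub>R vel t = r *\<^sub>R (z t - x t)"
      using x_0 z_0 by (simp add: vel_def)
    then have "t * (vel t \<bullet> p) = r * ((z t - x t) \<bullet> p)"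
      by (metis inner_scaleR_left)
    moreover have "r * (t\<^sup>2 / (2 * (r + 2)) * (p \<bullet> p)) + t * (t / (r + 2) * (p \<bullet> p)) = t\<^sup>2 / 2 * (p \<bullet> p)"
      using r by (simp add: divide_simps power2_eq_square) (simp add: algebra_simps)
    ultimately show ?thesis
      unfolding m_def shifted_def shifted_vel_def inner_add_left inner_diff_left inner_scaleR_left
        distrib_left right_diff_distrib
      by linarith
  qed
  moreover have "t * (shifted_vel t \<bullet> p) \<le> 0"
    using assms inner_shifted_vel_nonpos by (intro mult_nonneg_nonpos)
  ultimately have "- (shifted t \<bullet> p) * r \<le> (r + 2) * gap x0"
    by (simp add: mult.commute)
  then show ?thesis
    using r by (simp only: times_divide_eq_left pos_le_divide_eq)
qed

section \<open>Bounds for the rescaled displacement\<close>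

lemma rescaled_displacement_eq:
  assumes "t > 0"
  shows "- ((2 * (r + 2) / t\<^sup>2) *\<^sub>R (x t - x0)) = p - (2 * (r + 2) / t\<^sup>2) *\<^sub>R shifted t"
proof -
  have "2 * (r + 2) / t\<^sup>2 * (t\<^sup>2 / (2 * (r + 2))) = 1"
    using assms r by simp
  then show ?thesis
    unfolding shifted_def scaleR_add_right scaleR_scaleR by simp
qed

lemma rescaled_displacement_dist_le:
  assumes "t > 0" and q: "q = - ((2 * (r + 2) / t\<^sup>2) *\<^sub>R (x t - x0))"
  shows "(norm (q - p))\<^sup>2 \<le> 8 * (r + 2)\<^sup>2 * gap x0 / t\<^sup>2"
proof -
  have "(norm (q - p))\<^sup>2 = (2 * (r + 2) / t\<^sup>2)\<^sup>2 * (norm (shifted t))\<^sup>2"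
    unfolding q rescaled_displacement_eq[OF assms(1)] by (simp add: power_mult_distrib power_divide)
  also have "\<dots> \<le> (2 * (r + 2) / t\<^sup>2)\<^sup>2 * (sqrt (2 * gap x0) * t)\<^sup>2"
    by (intro mult_left_mono power_mono norm_shifted_le assms) auto
  also have "\<dots> = 8 * (r + 2)\<^sup>2 * gap x0 / t\<^sup>2"
  proof -
    have "(sqrt (2 * gap x0) * t)\<^sup>2 = 2 * gap x0 * t\<^sup>2"
      using gap_nonneg[of x0] by (simp add: power_mult_distrib)
    moreover have "(2 * k / s)\<^sup>2 * (2 * d * s) = 8 * k\<^sup>2 * d / s" if "s \<noteq> 0" for k d s :: real
      using that by (simp add: power2_eq_square)
    moreover have "t\<^sup>2 \<noteq> 0"
      using assms(1) by simp
    ultimately show ?thesis by metis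
  qed
  finally show ?thesis .
qed

text \<open>Expanding the square around \<open>p\<close>, the distance bound contributes
  \<open>2\<close> and the cross term \<open>1 / r\<close> to the constant.\<close>

lemma rescaled_displacement_norm_le:
  assumes "t > 0" and q: "q = - ((2 * (r + 2) / t\<^sup>2) *\<^sub>R (x t - x0))"
  shows "(norm q)\<^sup>2 - (norm p)\<^sup>2 \<le> 4 * (r + 2)\<^sup>2 * gap x0 * ((2 + 1 / r) / t\<^sup>2)"
proof -
  have "(norm q)\<^sup>2 - (norm p)\<^sup>2 = (norm (q - p))\<^sup>2 + 2 * ((q - p) \<bullet> p)"
    by (simp add: power2_norm_eq_inner inner_diff_left inner_diff_right inner_commute)
  also have "(q - p) \<bullet> p = (2 * (r + 2) / t\<^sup>2) * - (shifted t \<bullet> p)"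
    unfolding q rescaled_displacement_eq[OF assms(1)] by (simp add: inner_diff_left)
  also have "(norm (q - p))\<^sup>2 + 2 * ((2 * (r + 2) / t\<^sup>2) * - (shifted t \<bullet> p))
      \<le> 8 * (r + 2)\<^sup>2 * gap x0 / t\<^sup>2 + 2 * ((2 * (r + 2) / t\<^sup>2) * ((r + 2) / r * gap x0))"
    using r assms by (intro add_mono mult_left_mono rescaled_displacement_dist_le inner_shifted_ge) auto
  also have "\<dots> = 4 * (r + 2)\<^sup>2 * gap x0 * ((2 + 1 / r) / t\<^sup>2)"
  proof -
    have "8 * k\<^sup>2 * d / s + 2 * ((2 * k / s) * (k / r * d)) = 4 * k\<^sup>2 * d * ((2 + 1 / r) / s)"
      for k d s :: real
      by (simp add: power2_eq_square add_divide_distrib distrib_left mult_ac)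
    then show ?thesis by this
  qed
  finally show ?thesis .
qed

end

section \<open>Transfer of the real estimates to the extended-real statement\<close>

theorem theorem4p4:
  fixes f :: "real ^ 'n \<Rightarrow> real" and r :: real and x0 :: "real ^ 'n"
    and x z q :: "real \<Rightarrow> real ^ 'n"
  assumes f: "f \<in> smooth_convex_fin"
    and r: "r > 0"
    and sol: "nag_solution f r x0 x z"
    and q: "\<And>t. t > 0 \<Longrightarrow> q t = - ((2 * (r + 2) / t\<^sup>2) *\<^sub>R (x t - x 0))"
  shows "(\<forall>t>0. q t \<in> conjugate_dom f) \<and>
    (\<forall>pstar. is_arg_min norm (\<lambda>p. p \<in> conjugate_dom f) pstar \<longrightarrow>
      (\<forall>t>0. ereal ((norm (q t - pstar))\<^sup>2)
          \<le> ereal (8 * (r + 2)\<^sup>2) * dual_div f x0 pstar / ereal (t\<^sup>2)) \<and>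
      (\<exists>C::real. \<forall>\<^sub>F t in at_top.
          ereal ((norm (q t))\<^sup>2 - (norm pstar)\<^sup>2)
            \<le> ereal (4 * (r + 2)\<^sup>2) * dual_div f x0 pstar * ereal ((C + ln t) / t\<^sup>2)))"
proof -
  interpret nag_flow f r x0 x z
    using f r sol by unfold_locales
  have q_eq: "q t = - ((2 * (r + 2) / t\<^sup>2) *\<^sub>R (x t - x0))" if "t > 0" for t
    using q[OF that] by (simp add: x_0)
  show ?thesis
  proof (intro conjI allI impI)
    fix t :: real assume "t > 0"
    then show "q t \<in> conjugate_dom f"
      by (simp only: q_eq rescaled_displacement_in_conjugate_dom)
  next
    fix p t assume p: "is_arg_min norm (\<lambda>p. p \<in> conjugate_dom f) p" and t: "t > (0::real)"
    then obtain c where c: "conjugate f p = ereal c"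
      by (auto simp: is_arg_min_def elim: conjugate_domE)
    interpret nag_flow_min_norm f r x0 x z p c
      using p c by unfold_locales
    show "ereal ((norm (q t - p))\<^sup>2) \<le> ereal (8 * (r + 2)\<^sup>2) * dual_div f x0 p / ereal (t\<^sup>2)"
      using rescaled_displacement_dist_le[OF t q_eq[OF t]] t by (simp add: dual_div_eq_gap)
  next
    fix p assume p: "is_arg_min norm (\<lambda>p. p \<in> conjugate_dom f) p"
    then obtain c where c: "conjugate f p = ereal c"
      by (auto simp: is_arg_min_def elim: conjugate_domE)
    interpret nag_flow_min_norm f r x0 x z p c
      using p c by unfold_locales
    \<comment> \<open>The constant is the one from the bound without logarithm; for
      \<open>t \<ge> 1\<close> the added \<open>ln t\<close> is nonnegative and only weakens
      it.\<close>
    have "\<forall>\<^sub>F t in at_top. ereal ((norm (q t))\<^sup>2 - (norm p)\<^sup>2)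
        \<le> ereal (4 * (r + 2)\<^sup>2) * dual_div f x0 p * ereal ((2 + 1 / r + ln t) / t\<^sup>2)"
      using eventually_ge_at_top[of "1::real"]
    proof eventually_elim
      case (elim t)
      then have t: "t > 0" by simp
      have "4 * (r + 2)\<^sup>2 * gap x0 * ((2 + 1 / r) / t\<^sup>2)
          \<le> 4 * (r + 2)\<^sup>2 * gap x0 * ((2 + 1 / r + ln t) / t\<^sup>2)"
        using elim gap_nonneg[of x0] by (intro mult_left_mono divide_right_mono) auto
      with rescaled_displacement_norm_le[OF t q_eq[OF t]] show ?case
        by (simp add: dual_div_eq_gap)
    qed
    then show "\<exists>C::real. \<forall>\<^sub>F t in at_top. ereal ((norm (q t))\<^sup>2 - (norm p)\<^sup>2)
        \<le> ereal (4 * (r + 2)\<^sup>2) * dual_div f x0 p * ereal ((C + ln t) / t\<^sup>2)" ..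
  qed
qed

end
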